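(* Let $G$ be a finite simple graph that is $(P_3\cup P_2, C_5)$-free, i.e. $G$ has no induced subgraph isomorphic to $P_3\cup P_2$ and no induced subgraph isomorphic to $C_5$. Then $$\chi(G)\le \frac{3\omega(G)^2+\omega(G)}{2}.$$
   Context: All graphs are finite and simple. $\chi(G)$ is the chromatic number of $G$ and $\omega(G)$ is the clique number (maximum size of a clique). $P_k$ and $C_k$ denote the path and the cycle on $k$ vertices. For vertex-disjoint graphs $A,B$, the union $A\cup B$ is their disjoint union; thus $P_3\cup P_2$ has 5 vertices $a,b,c,d,e$ and exactly the edges $ab,bc,de$. *)

theory Defs
  imports Complex_Main "Graph_Theory.Digraph_Component" "Graph_Theory.Digraph_Isomorphism"
begin

text \<open>
  Finite simple graphs are the library's \<open>pair_graph\<close>s: finite, loopless, symmetric digraphs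
  whose arcs are pairs of vertices, an undirected edge \<open>uv\<close> being the two arcs \<open>(u, v)\<close> and
  \<open>(v, u)\<close>.
\<close>

definition path_graph :: "nat \<Rightarrow> nat pair_pre_digraph" where
  "path_graph k = \<lparr> pverts = {..<k},
     parcs = {(i, j). i < k \<and> j < k \<and> (j = Suc i \<or> i = Suc j)} \<rparr>"

text \<open>This is the cycle \<open>C\<^sub>k\<close> only for \<open>k \<ge> 3\<close>; \<open>k = 1\<close> gives a loop, \<open>k = 2\<close> a single edge.\<close>

definition cycle_graph :: "nat \<Rightarrow> nat pair_pre_digraph" where
  "cycle_graph k = \<lparr> pverts = {..<k},
     parcs = {(i, j). i < k \<and> j < k \<and> (j = Suc i mod k \<or> i = Suc j mod k)} \<rparr>"

definition disjoint_union_graph ::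
    "'a pair_pre_digraph \<Rightarrow> 'b pair_pre_digraph \<Rightarrow> ('a + 'b) pair_pre_digraph" where
  "disjoint_union_graph A B = \<lparr> pverts = pverts A <+> pverts B,
     parcs = map_prod Inl Inl ` parcs A \<union> map_prod Inr Inr ` parcs B \<rparr>"

text \<open>Quantifying \<open>K\<close> over \<open>pair_pre_digraph\<close>s loses nothing: an induced subgraph inherits
  the maps \<open>tail = fst\<close> and \<open>head = snd\<close>.\<close>

definition induced_free :: "'a pair_pre_digraph \<Rightarrow> 'b pair_pre_digraph \<Rightarrow> bool" where
  "induced_free G H \<longleftrightarrow>
     \<not> (\<exists>K. induced_subgraph (with_proj K) (with_proj G) \<and> digraph_iso (with_proj K) (with_proj H))"

definition is_clique :: "'a pair_pre_digraph \<Rightarrow> 'a set \<Rightarrow> bool" where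
  "is_clique G S \<longleftrightarrow> S \<subseteq> pverts G \<and> pairwise (\<lambda>u v. (u, v) \<in> parcs G) S"

definition clique_number :: "'a pair_pre_digraph \<Rightarrow> nat" where
  "clique_number G = Max {card S |S. is_clique G S}"

definition proper_colouring :: "'a pair_pre_digraph \<Rightarrow> nat \<Rightarrow> ('a \<Rightarrow> nat) \<Rightarrow> bool" where
  "proper_colouring G k c \<longleftrightarrow>
     (\<forall>v\<in>pverts G. c v < k) \<and> (\<forall>(u, v)\<in>parcs G. c u \<noteq> c v)"

definition chromatic_number :: "'a pair_pre_digraph \<Rightarrow> nat" where
  "chromatic_number G = (LEAST k. \<exists>c. proper_colouring G k c)"

end

theory Submission
  imports Defs
begin

text \<open>
  The stronger bound \<open>\<chi> \<le> g(\<omega>)\<close> with \<open>g(n) = (3n\<^sup>2 - n) / 2\<close> holds, by induction on the number of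
  vertices. Let \<open>n = \<omega>(G)\<close>, let \<open>x\<close> be a vertex and \<open>C\<close> a maximum clique, of size \<open>a\<close>, among the
  non-neighbours of \<open>x\<close>. If two non-adjacent neighbours of \<open>x\<close> miss (are non-adjacent to) sets
  \<open>S\<close>, \<open>S'\<close> of vertices of \<open>C\<close>, then \<open>S\<close> and \<open>S'\<close> are nested, by \<open>C\<^sub>5\<close>-freeness, and share at most one
  vertex, by \<open>(P\<^sub>3 \<union> P\<^sub>2)\<close>-freeness. Hence the neighbours of \<open>x\<close> that miss at least two vertices of
  \<open>C\<close> form a clique, while the sets \<open>{c} \<union> W c\<close>, where \<open>W c\<close> consists of the neighbours missing
  exactly \<open>c \<in> C\<close>, are pairwise completely joined, so that their clique numbers add up to at most
  \<open>n\<close>.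

  If \<open>a < n\<close> and \<open>g(a) \<le> g(n) - g(n - 1)\<close>, colour the neighbours and the non-neighbours of \<open>x\<close>
  separately. If \<open>a < n\<close> and \<open>g(a)\<close> is larger, let \<open>J \<subseteq> C\<close> consist of those \<open>c\<close> for which \<open>W c\<close> has a
  small clique number: the neighbours complete to \<open>J\<close> have clique number at most \<open>n - |J|\<close>, and
  this gain pays for the rest. If \<open>a = n\<close> for all vertices, then neighbourhoods need only \<open>2n - 2\<close>
  colours, and \<open>G\<close> is covered by the neighbourhoods of two adjacent vertices and their common
  non-neighbourhood, a disjoint union of cliques.
\<close>

section \<open>Clique numbers and colourings of vertex sets\<close>

text \<open>The relation stays fixed while the vertex set varies, so an induced subgraph is simply a
  subset.\<close>

definition omega :: "('a \<Rightarrow> 'a \<Rightarrow> bool) \<Rightarrow> 'a set \<Rightarrow> nat" where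
  "omega E S = Max {card K |K. K \<subseteq> S \<and> pairwise E K}"

definition colourable :: "('a \<Rightarrow> 'a \<Rightarrow> bool) \<Rightarrow> 'a set \<Rightarrow> nat \<Rightarrow> bool" where
  "colourable E S k \<longleftrightarrow> (\<exists>c::'a \<Rightarrow> nat. (\<forall>v\<in>S. c v < k) \<and> (\<forall>u\<in>S. \<forall>v\<in>S. E u v \<longrightarrow> c u \<noteq> c v))"

lemma finite_clique_cards:
  assumes "finite S"
  shows "finite {card K |K. K \<subseteq> S \<and> pairwise E K}"
proof -
  have "{card K |K. K \<subseteq> S \<and> pairwise E K} \<subseteq> card ` Pow S" by auto
  then show ?thesis using assms by (meson finite_Pow_iff finite_imageI finite_subset)
qed

lemma card_le_omega:
  assumes "finite S" "K \<subseteq> S" "pairwise E K"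
  shows "card K \<le> omega E S"
  unfolding omega_def using assms finite_clique_cards by (intro Max_ge) auto

lemma omega_clique:
  assumes "finite S"
  obtains K where "K \<subseteq> S" "pairwise E K" "card K = omega E S"
proof -
  have "card {} \<in> {card K |K. K \<subseteq> S \<and> pairwise E K}" by (auto simp: pairwise_def intro!: exI[of _ "{}"])
  then have "omega E S \<in> {card K |K. K \<subseteq> S \<and> pairwise E K}"
    unfolding omega_def using finite_clique_cards[OF assms] by (intro Max_in) auto
  then show ?thesis using that by auto
qed

lemma omega_mono:
  assumes "finite S" "T \<subseteq> S"
  shows "omega E T \<le> omega E S"
  by (metis assms card_le_omega finite_subset omega_clique subset_trans)

lemma omega_pos:
  assumes "finite S" "x \<in> S"
  shows "0 < omega E S"
  using card_le_omega[of S "{x}" E] assms by (simp add: pairwise_def)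

lemma colourable_mono:
  assumes "colourable E S k" "T \<subseteq> S" "k \<le> l"
  shows "colourable E T l"
proof -
  obtain c where "\<forall>v\<in>S. c v < k" "\<forall>u\<in>S. \<forall>v\<in>S. E u v \<longrightarrow> c u \<noteq> c v"
    using assms(1) unfolding colourable_def by blast
  then show ?thesis unfolding colourable_def
    using assms(2,3) by (intro exI[of _ c]) fastforce
qed

lemma colourable_empty: "colourable E {} k"
  by (simp add: colourable_def)

lemma colourable_card:
  assumes "finite S" "irreflp E"
  shows "colourable E S (card S)"
proof -
  obtain f where f: "bij_betw f S {0..<card S}"
    using ex_bij_betw_finite_nat[OF assms(1)] by blast
  then show ?thesis unfolding colourable_def
    using assms(2) by (intro exI[of _ f]) (auto simp: bij_betw_def inj_on_def irreflp_def)
qed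

lemma colourable_indep:
  assumes "\<And>u v. u \<in> S \<Longrightarrow> v \<in> S \<Longrightarrow> \<not> E u v"
  shows "colourable E S 1"
  using assms unfolding colourable_def by (intro exI[of _ "\<lambda>_. 0"]) auto

lemma colourable_Un:
  assumes "colourable E S k" "colourable E T l"
  shows "colourable E (S \<union> T) (k + l)"
proof -
  obtain c d where c: "\<forall>v\<in>S. c v < k" "\<forall>u\<in>S. \<forall>v\<in>S. E u v \<longrightarrow> c u \<noteq> c v"
    and d: "\<forall>v\<in>T. d v < l" "\<forall>u\<in>T. \<forall>v\<in>T. E u v \<longrightarrow> d u \<noteq> d v"
    using assms unfolding colourable_def by blast
  \<comment> \<open>The palette of \<open>T\<close> is shifted by \<open>k\<close>; a vertex in both
    sets keeps its colour from \<open>S\<close>.\<close>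
  have "(if u \<in> S then c u else k + d u) \<noteq> (if v \<in> S then c v else k + d v)"
    if "u \<in> S \<union> T" "v \<in> S \<union> T" "E u v" for u v
    using that c(2) d(2) c(1)[rule_format, of u] c(1)[rule_format, of v] by auto
  then show ?thesis unfolding colourable_def using c(1) d(1)
    by (intro exI[of _ "\<lambda>v. if v \<in> S then c v else k + d v"]) (auto intro: trans_less_add1)
qed

lemma colourable_UN:
  assumes "finite J" "\<And>c. c \<in> J \<Longrightarrow> colourable E (W c) (k c)"
  shows "colourable E (\<Union>c\<in>J. W c) (\<Sum>c\<in>J. k c)"
  using assms
  by (induction J rule: finite_induct) (auto simp: colourable_empty intro: colourable_Un)

text \<open>Without edges between them the two sets can share one palette.\<close>

lemma colourable_Un_anticomplete:
  assumes "colourable E S k" "colourable E T k" "\<And>u v. u \<in> S \<Longrightarrow> v \<in> T \<Longrightarrow> \<not> E u v" "symp E"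
  shows "colourable E (S \<union> T) k"
proof -
  obtain c d where c: "\<forall>v\<in>S. c v < k" "\<forall>u\<in>S. \<forall>v\<in>S. E u v \<longrightarrow> c u \<noteq> c v"
    and d: "\<forall>v\<in>T. d v < k" "\<forall>u\<in>T. \<forall>v\<in>T. E u v \<longrightarrow> d u \<noteq> d v"
    using assms unfolding colourable_def by blast
  have "(if u \<in> S then c u else d u) \<noteq> (if v \<in> S then c v else d v)"
    if "u \<in> S \<union> T" "v \<in> S \<union> T" "E u v" for u v
    using that c(2) d(2) assms(3)[of u v] assms(3)[of v u] sympD[OF assms(4) that(3)] by auto
  then show ?thesis unfolding colourable_def using c(1) d(1)
    by (intro exI[of _ "\<lambda>v. if v \<in> S then c v else d v"]) auto
qed

text \<open>Such an \<open>F\<close> is a disjoint union of cliques: the closed neighbourhood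
  \<open>K\<close> of any vertex is a clique that no edge leaves, and it is peeled off.\<close>

lemma colourable_P3_free:
  assumes "finite F" "symp E" "irreflp E"
    and P3: "\<And>a b c. a \<in> F \<Longrightarrow> b \<in> F \<Longrightarrow> c \<in> F \<Longrightarrow> E a b \<Longrightarrow> E b c \<Longrightarrow> a \<noteq> c \<Longrightarrow> E a c"
  shows "colourable E F (omega E F)"
  using assms(1) P3
proof (induction F rule: finite_psubset_induct)
  case (psubset F)
  show ?case
  proof (cases "F = {}")
    case True
    then show ?thesis by (simp add: colourable_empty)
  next
    case False
    then obtain y where y: "y \<in> F" by blast
    define K where "K = insert y {z \<in> F. E y z}"
    have sym: "E u v \<Longrightarrow> E v u" for u v using assms(2) by (rule sympD)
    have K: "K \<subseteq> F" "finite K" using y psubset.hyps by (auto simp: K_def)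
    have "pairwise E K"
    proof (rule pairwiseI)
      fix u v assume "u \<in> K" "v \<in> K" "u \<noteq> v"
      then show "E u v" using y psubset.prems[of u y v] sym[of y u] sym[of y v] by (auto simp: K_def)
    qed
    then have "card K \<le> omega E F" using K psubset.hyps by (intro card_le_omega)
    then have 1: "colourable E K (omega E F)"
      using colourable_card[OF K(2) assms(3)] by (meson colourable_mono order_refl)
    have "colourable E (F - K) (omega E (F - K))"
    proof (rule psubset.IH)
      show "F - K \<subset> F" using y by (auto simp: K_def)
      show "E a c" if "a \<in> F - K" "b \<in> F - K" "c \<in> F - K" "E a b" "E b c" "a \<noteq> c" for a b c
        using psubset.prems[of a b c] that by blast
    qed
    then have 2: "colourable E (F - K) (omega E F)"
      using omega_mono[OF psubset.hyps, of "F - K" E] by (meson Diff_subset colourable_mono order_refl)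
    have "\<not> E u v" if "u \<in> K" "v \<in> F - K" for u v
    proof
      assume "E u v"
      then show False using that y psubset.prems[of y u v] by (auto simp: K_def)
    qed
    then have "colourable E (K \<union> (F - K)) (omega E F)"
      by (rule colourable_Un_anticomplete[OF 1 2 _ assms(2)])
    then show ?thesis using K(1) by (simp add: Un_absorb1)
  qed
qed

text \<open>Maximum cliques of the sets together form a clique; irreflexivity makes completely
  joined sets disjoint, so the sizes add.\<close>

lemma sum_omega_join_le:
  assumes "finite J" "\<And>c. c \<in> J \<Longrightarrow> finite (T c)" "symp E" "irreflp E"
    and join: "\<And>c c' u v. c \<in> J \<Longrightarrow> c' \<in> J \<Longrightarrow> c \<noteq> c' \<Longrightarrow> u \<in> T c \<Longrightarrow> v \<in> T c' \<Longrightarrow> E u v"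
  shows "(\<Sum>c\<in>J. omega E (T c)) \<le> omega E (\<Union>c\<in>J. T c)"
proof -
  have "\<forall>c\<in>J. \<exists>K. K \<subseteq> T c \<and> pairwise E K \<and> card K = omega E (T c)"
    by (meson assms(2) omega_clique)
  then obtain K where K: "\<And>c. c \<in> J \<Longrightarrow> K c \<subseteq> T c \<and> pairwise E (K c) \<and> card (K c) = omega E (T c)"
    by metis
  have "pairwise E (\<Union>c\<in>J. K c)"
  proof (rule pairwiseI)
    fix u v assume "u \<in> (\<Union>c\<in>J. K c)" "v \<in> (\<Union>c\<in>J. K c)" "u \<noteq> v"
    then obtain c c' where c: "c \<in> J" "c' \<in> J" "u \<in> K c" "v \<in> K c'" by blast
    show "E u v"
    proof (cases "c = c'")
      case True
      then show ?thesis using c K[of c] \<open>u \<noteq> v\<close> by (auto simp: pairwise_def)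
    next
      case False
      then show ?thesis using c K join by blast
    qed
  qed
  then have le: "card (\<Union>c\<in>J. K c) \<le> omega E (\<Union>c\<in>J. T c)"
    using K assms(1,2) by (intro card_le_omega) blast+
  have "K c \<inter> K c' = {}" if "c \<in> J" "c' \<in> J" "c \<noteq> c'" for c c'
    using that K[of c] K[of c'] join[of c c'] assms(4) by (metis disjoint_iff irreflpD subsetD)
  moreover have "\<forall>c\<in>J. finite (K c)" using assms(2) K by (meson finite_subset)
  ultimately have "card (\<Union>c\<in>J. K c) = (\<Sum>c\<in>J. card (K c))"
    using assms(1) by (intro card_UN_disjoint) auto
  also have "\<dots> = (\<Sum>c\<in>J. omega E (T c))" using K by simp
  finally show ?thesis using le by simp
qed

lemma omega_complete_le:
  assumes "finite S" "R \<subseteq> S" "J \<subseteq> S" "pairwise E J" "symp E" "irreflp E"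
    and compl: "\<And>u v. u \<in> R \<Longrightarrow> v \<in> J \<Longrightarrow> E u v"
  shows "omega E R + card J \<le> omega E S"
proof -
  have fin: "finite R" "finite J" using assms(1-3) by (auto intro: finite_subset)
  obtain K where K: "K \<subseteq> R" "pairwise E K" "card K = omega E R"
    using omega_clique[OF fin(1)] .
  have "pairwise E (K \<union> J)"
    using K assms(4,5) compl unfolding pairwise_def by (metis Un_iff subsetD sympD)
  then have "card (K \<union> J) \<le> omega E S" using K(1) assms(1-3) by (intro card_le_omega) auto
  moreover have "K \<inter> J = {}" using K(1) compl assms(6) by (metis disjoint_iff irreflpD subsetD)
  ultimately show ?thesis
    using K fin by (metis card_Un_disjoint finite_subset)
qed

section \<open>The bound g and its arithmetic\<close>

text \<open>The pentagonal numbers. The recursion exposes the increment g(n) - g(n - 1) = 3n - 2,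
  the budget for the non-neighbours of a vertex whose neighbours take g(n - 1) colours.\<close>

fun chi_bound :: "nat \<Rightarrow> nat" where
  "chi_bound 0 = 0"
| "chi_bound (Suc n) = chi_bound n + 3 * n + 1"

lemma chi_bound_eq: "2 * chi_bound n + n = 3 * n^2"
  by (induction n) (auto simp: power2_eq_square algebra_simps)

lemma chi_bound_real: "real (chi_bound n) = (3 * real n ^ 2 - real n) / 2"
proof -
  have "real (2 * chi_bound n + n) = real (3 * n^2)" by (simp only: chi_bound_eq)
  then show ?thesis by (simp add: field_simps)
qed

lemma chi_bound_mono: "m \<le> n \<Longrightarrow> chi_bound m \<le> chi_bound n"
  by (rule lift_Suc_mono_le[of chi_bound]) auto

lemma chi_bound_int: "2 * int (chi_bound w) = 3 * (int w)^2 - int w"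
proof -
  have "int (2 * chi_bound w + w) = int (3 * w^2)" by (simp only: chi_bound_eq)
  then show ?thesis by simp
qed

text \<open>By convexity \<open>2 * chi_bound w\<close> lies below its chord through
  \<open>w = 1\<close> and \<open>w = a\<close>; the difference is
  \<open>3 * (w - 1) * (a - w)\<close>.\<close>

lemma chi_bound_le_linear:
  assumes "1 \<le> w" "w \<le> a"
  shows "2 * int (chi_bound w) \<le> 2 + (3 * int a + 2) * (int w - 1)"
proof -
  have "3 * (int w - 1) * (int a - int w) \<ge> 0" using assms by simp
  then show ?thesis unfolding chi_bound_int by (simp add: algebra_simps power2_eq_square)
qed

text \<open>\<open>5 * n - 4\<close> is \<open>2 * (2 * n - 2) + n\<close>, the cost of two
  neighbourhoods and a union of cliques. At \<open>n = 2\<close> the inequality fails, 10 against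
  9.\<close>

lemma chi_bound_ge_linear: "3 \<le> n \<Longrightarrow> 5 * n \<le> chi_bound n + 4"
proof (induction n rule: dec_induct)
  case base
  show ?case by (simp add: numeral_3_eq_3)
next
  case (step n)
  then show ?case by simp
qed

text \<open>
  In the application \<open>C\<close> is the clique of the header, \<open>w c\<close> is the clique number of \<open>{c} \<union> W c\<close>, and
  the terms count colours for: the neighbours complete to \<open>J\<close>, the non-neighbours, the
  neighbours missing two vertices of \<open>C\<close>, and the sets \<open>W c\<close> with \<open>c \<in> J\<close>.
\<close>
lemma exists_cheap_subset:
  fixes w :: "'c \<Rightarrow> nat"
  assumes "finite C" "card C < n" "\<And>c. c \<in> C \<Longrightarrow> 1 \<le> w c" "(\<Sum>c\<in>C. w c) \<le> n"
    and big: "3 * n \<le> chi_bound (card C) + 1"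
  obtains J where "J \<subseteq> C" "chi_bound (n - card J) + chi_bound (card C) + (n - 1) + (\<Sum>c\<in>J. chi_bound (w c)) \<le> chi_bound n"
proof -
  define a where "a = card C"
  define m where "m = n - a"
  have n: "n = m + a" "1 \<le> m" using assms(2) by (auto simp: m_def a_def)
  have a3: "3 \<le> a"
  proof (rule ccontr)
    assume "\<not> 3 \<le> a"
    then have "a = 0 \<or> a = 1 \<or> a = 2" by linarith
    then show False using big n(2) unfolding a_def[symmetric] n(1) by (auto simp: numeral_2_eq_2)
  qed
  \<comment> \<open>Each of the \<open>a\<close> numbers is at least 1, and they add up to at most
    \<open>m + a\<close>.\<close>
  have excess: "(\<Sum>c\<in>C. w c - 1) \<le> m"
  proof -
    have "(\<Sum>c\<in>C. w c - 1) + (\<Sum>c\<in>C. 1) = (\<Sum>c\<in>C. w c)"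
      unfolding sum.distrib[symmetric] using assms(3) by (intro sum.cong refl le_add_diff_inverse2)
    then show ?thesis using assms(4) n(1) by (simp add: a_def)
  qed
  \<comment> \<open>Each index left out of \<open>J\<close> uses up at least \<open>t\<close> of the
    total excess \<open>m\<close>. With \<open>t = a\<close> the chord bound covers all of
    \<open>J\<close>; for \<open>m = 1\<close> the sharper \<open>t = 1\<close> leaves only
    \<open>w c = 1\<close> in \<open>J\<close>.\<close>
  define t where "t = (if m = 1 then 1 else a)"
  define J where "J = {c \<in> C. w c \<le> t}"
  define r where "r = card (C - J)"
  have J: "J \<subseteq> C" "finite J" using assms(1) by (auto simp: J_def)
  have card_J: "card J + r = a" using J assms(1) by (simp add: r_def a_def card_Diff_subset card_mono)
  have split: "(\<Sum>c\<in>C. w c - 1) = (\<Sum>c\<in>J. w c - 1) + (\<Sum>c\<in>C - J. w c - 1)"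
    using J(1) assms(1) by (metis add.commute sum.subset_diff)
  have "(\<Sum>c\<in>C - J. t) \<le> (\<Sum>c\<in>C - J. w c - 1)"
    by (rule sum_mono) (auto simp: J_def)
  then have "r * t \<le> (\<Sum>c\<in>C - J. w c - 1)" by (simp add: r_def)
  then have J_excess: "(\<Sum>c\<in>J. w c - 1) + r * t \<le> m" using split excess by linarith
  have "chi_bound (m + r) + chi_bound a + (m + a - 1) + (\<Sum>c\<in>J. chi_bound (w c)) \<le> chi_bound (m + a)"
  proof (cases "m = 1")
    case True
    have "w c = 1" if "c \<in> J" for c using that assms(3)[of c] True by (auto simp: J_def t_def)
    then have "(\<Sum>c\<in>J. chi_bound (w c)) = card J" by simp
    moreover have "r = 0 \<or> r = 1" using J_excess True by (auto simp: t_def)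
    \<comment> \<open>For \<open>r = 1\<close> this comes down to \<open>3 \<le> a\<close>.\<close>
    ultimately show ?thesis using True card_J a3 by (auto simp: numeral_2_eq_2)
  next
    case False
    then have m2: "2 \<le> m" and t: "t = a" using n(2) by (auto simp: t_def)
    have "2 * int (\<Sum>c\<in>J. chi_bound (w c)) = (\<Sum>c\<in>J. 2 * int (chi_bound (w c)))" by (simp add: sum_distrib_left)
    also have "\<dots> \<le> (\<Sum>c\<in>J. 2 + (3 * int a + 2) * int (w c - 1))"
    proof (rule sum_mono)
      fix c assume "c \<in> J"
      then have "1 \<le> w c" "w c \<le> a" using assms(3) t by (auto simp: J_def)
      then show "2 * int (chi_bound (w c)) \<le> 2 + (3 * int a + 2) * int (w c - 1)"
        using chi_bound_le_linear[of "w c" a] by (simp add: of_nat_diff)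
    qed
    also have "\<dots> = 2 * int (card J) + (3 * int a + 2) * int (\<Sum>c\<in>J. w c - 1)"
      by (simp add: sum.distrib sum_distrib_left)
    also have "\<dots> \<le> 2 * (int a - int r) + (3 * int a + 2) * (int m - int r * int a)"
    proof -
      have "int (\<Sum>c\<in>J. w c - 1) \<le> int m - int r * int a"
        using J_excess t by (metis add_le_imp_le_diff le_diff_eq of_nat_add of_nat_le_iff of_nat_mult)
      then have "(3 * int a + 2) * int (\<Sum>c\<in>J. w c - 1) \<le> (3 * int a + 2) * (int m - int r * int a)"
        by (intro mult_left_mono) auto
      moreover have "int (card J) = int a - int r" using card_J by linarith
      ultimately show ?thesis by (simp only: add_left_mono)
    qed
    finally have cost: "2 * int (\<Sum>c\<in>J. chi_bound (w c))
      \<le> 2 * (int a - int r) + (3 * int a + 2) * (int m - int r * int a)" .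
    have "6 * (int m + int a) \<le> 3 * (int a)^2 - int a + 2"
    proof -
      have "3 * (int m + int a) \<le> int (chi_bound a) + 1" using big n(1) unfolding a_def[symmetric] by simp
      then have "6 * (int m + int a) \<le> 2 * int (chi_bound a) + 2" by linarith
      then show ?thesis by (simp only: chi_bound_int)
    qed
    \<comment> \<open>In the inequality derived from these four products, right side minus left side
      is the first product, plus 3 times the second, 6 times the third, the fourth, \<open>r\<close>
      and \<open>2 * (a - 3)\<close>.\<close>
    then have "0 \<le> int r * (3 * (int a)^2 - 6 * int m - 7 * int a + 2)" by simp
    moreover have "0 \<le> int r * (int a - int r)" using card_J by simp
    moreover have "0 \<le> int r * int a" by simp
    moreover have "0 \<le> (3 * int a - 4) * (int m - 2)" using a3 m2 by simp
    ultimately have "3 * (int m + int r)^2 - (int m + int r) + (3 * (int a)^2 - int a) + 2 * (int m + int a - 1)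
      + (2 * (int a - int r) + (3 * int a + 2) * (int m - int r * int a))
      \<le> 3 * (int m + int a)^2 - (int m + int a)"
      using a3 by (simp only: algebra_simps power2_eq_square)
    then have "2 * int (chi_bound (m + r)) + 2 * int (chi_bound a) + 2 * (int m + int a - 1) + 2 * int (\<Sum>c\<in>J. chi_bound (w c))
      \<le> 2 * int (chi_bound (m + a))"
      using cost chi_bound_int[of "m + r"] chi_bound_int[of a] chi_bound_int[of "m + a"] by (simp only: of_nat_add)
    moreover have "p + q + (m + a - 1) + s \<le> t"
      if "2 * int p + 2 * int q + 2 * (int m + int a - 1) + 2 * int s \<le> 2 * int t" for p q s t :: nat
      using that n(2) by simp
    ultimately show ?thesis by blast
  qed
  moreover have "n - card J = m + r" using n(1) card_J by linarith
  ultimately show ?thesis using that J(1) n(1) by (simp add: a_def)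
qed

section \<open>Structure forced by the two excluded subgraphs\<close>

text \<open>Besides \<open>a \<noteq> c\<close> in the first axiom, distinctness is automatic: any
  other coincidence contradicts irreflexivity or yields one of the listed edges.\<close>

locale P3P2_C5_free =
  fixes E :: "'a \<Rightarrow> 'a \<Rightarrow> bool"
  assumes symp: "symp E" and irreflp: "irreflp E"
    and no_P3_P2: "\<lbrakk>E a b; E b c; a \<noteq> c; \<not> E a c; E d e\<rbrakk>
      \<Longrightarrow> E a d \<or> E a e \<or> E b d \<or> E b e \<or> E c d \<or> E c e"
    and no_C5: "\<lbrakk>E a b; E b c; E c d; E d e; E e a\<rbrakk> \<Longrightarrow> E a c \<or> E b d \<or> E c e \<or> E d a \<or> E e b"
begin

lemma sym: "E u v \<Longrightarrow> E v u"
  using symp by (rule sympD)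

lemma irrefl: "\<not> E u u"
  using irreflp by (rule irreflpD)

definition miss :: "'a set \<Rightarrow> 'a \<Rightarrow> 'a set" where
  "miss C w = {c \<in> C. \<not> E w c}"

text \<open>If \<open>u\<close> is missed only by \<open>w\<close> and \<open>v\<close> only by
  \<open>w'\<close>, then \<open>x\<close>, \<open>w\<close>, \<open>v\<close>, \<open>u\<close>,
  \<open>w'\<close> is an induced 5-cycle. If distinct \<open>u\<close> and \<open>v\<close> are
  missed by both, the path \<open>w\<close>, \<open>x\<close>, \<open>w'\<close> and the edge
  \<open>uv\<close> induce the other excluded graph.\<close>

lemma nonadjacent_miss:
  assumes C: "pairwise E C" "\<forall>c\<in>C. \<not> E x c"
    and w: "E x w" "E x w'" "w \<noteq> w'" "\<not> E w w'"
  shows "miss C w \<subseteq> miss C w' \<or> miss C w' \<subseteq> miss C w"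
    and "u \<in> miss C w \<Longrightarrow> v \<in> miss C w \<Longrightarrow> u \<in> miss C w' \<Longrightarrow> v \<in> miss C w' \<Longrightarrow> u = v"
proof -
  show "miss C w \<subseteq> miss C w' \<or> miss C w' \<subseteq> miss C w"
  proof (rule ccontr)
    assume "\<not> ?thesis"
    then obtain u v where u: "u \<in> C" "\<not> E w u" "E w' u" and v: "v \<in> C" "\<not> E w' v" "E w v"
      unfolding miss_def by blast
    then have "E v u" using C(1) by (metis pairwiseD)
    then show False
      using no_C5[of x w v u w'] u v w C(2) sym by blast
  qed
next
  assume "u \<in> miss C w" "v \<in> miss C w" "u \<in> miss C w'" "v \<in> miss C w'"
  then have uv: "u \<in> C" "v \<in> C" "\<not> E w u" "\<not> E w v" "\<not> E w' u" "\<not> E w' v"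
    by (auto simp: miss_def)
  show "u = v"
  proof (rule ccontr)
    assume "u \<noteq> v"
    then have "E u v" using C(1) uv by (metis pairwiseD)
    then show False
      using no_P3_P2[of w x w' u v] uv w C(2) sym by blast
  qed
qed

text \<open>For non-adjacent vertices the smaller missed set would be the intersection, which has at
  most one element.\<close>

lemma pairwise_miss_two:
  assumes "finite C" "pairwise E C" "\<forall>c\<in>C. \<not> E x c"
  shows "pairwise E {w \<in> V. E x w \<and> 2 \<le> card (miss C w)}"
proof (rule pairwiseI)
  fix w w' assume w: "w \<in> {w \<in> V. E x w \<and> 2 \<le> card (miss C w)}"
    "w' \<in> {w \<in> V. E x w \<and> 2 \<le> card (miss C w)}" "w \<noteq> w'"
  show "E w w'"
  proof (rule ccontr)
    assume n: "\<not> E w w'"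
    have "card (miss C w \<inter> miss C w') \<le> 1"
      using nonadjacent_miss(2)[of C x w w'] assms n w
      by (simp add: card_le_Suc0_iff_eq miss_def)
    moreover have "miss C w \<inter> miss C w' = miss C w \<or> miss C w \<inter> miss C w' = miss C w'"
      using nonadjacent_miss(1)[of C x w w'] assms n w by blast
    ultimately show False using w by auto
  qed
qed

text \<open>\<open>{c}\<close> and \<open>{c'}\<close> are not nested, so
  \<open>nonadjacent_miss\<close> forces adjacency. The vertex \<open>c\<close> itself can be
  included because vertices missing only \<open>c'\<close> are adjacent to it.\<close>

lemma miss_one_join:
  assumes "pairwise E C" "\<forall>c\<in>C. \<not> E x c" "c \<in> C" "c' \<in> C" "c \<noteq> c'"
    and "u \<in> insert c {w \<in> V. E x w \<and> miss C w = {c}}"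
    and "v \<in> insert c' {w \<in> V. E x w \<and> miss C w = {c'}}"
  shows "E u v"
proof -
  have adj: "E z d" if "miss C z = {d'}" "d \<in> C" "d \<noteq> d'" for z d d'
    using that by (auto simp: miss_def)
  consider "u = c" "v = c'" | "u = c" "miss C v = {c'}" | "v = c'" "miss C u = {c}"
    | "E x u" "E x v" "miss C u = {c}" "miss C v = {c'}"
    using assms(6,7) by blast
  then show ?thesis
  proof cases
    case 1
    then show ?thesis using assms(1,3-5) by (auto simp: pairwise_def)
  next
    case 2
    then show ?thesis using adj[of v c' c] assms(3,5) sym by blast
  next
    case 3
    then show ?thesis using adj[of u c c'] assms(4,5) by blast
  next
    case *: 4
    show ?thesis
    proof (rule ccontr)
      assume n: "\<not> E u v"
      have "u \<noteq> v" using *(3,4) assms(5) by auto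
      then have "miss C u \<subseteq> miss C v \<or> miss C v \<subseteq> miss C u"
        using nonadjacent_miss(1)[OF assms(1) _ *(1,2) _ n] assms(2) by blast
      then show False using *(3,4) assms(5) by simp
    qed
  qed
qed


section \<open>A neighbourhood seen from a clique of non-neighbours\<close>

definition nbhd :: "'a set \<Rightarrow> 'a \<Rightarrow> 'a set" where
  "nbhd V x = {w \<in> V. E x w}"

definition conbhd :: "'a set \<Rightarrow> 'a \<Rightarrow> 'a set" where
  "conbhd V x = {w \<in> V. w \<noteq> x \<and> \<not> E x w}"

definition missing_one :: "'a set \<Rightarrow> 'a \<Rightarrow> 'a set \<Rightarrow> 'a \<Rightarrow> 'a set" where
  "missing_one V x C c = {w \<in> V. E x w \<and> miss C w = {c}}"

lemma omega_nbhd_less: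
  assumes "finite V" "x \<in> V"
  shows "omega E (nbhd V x) + 1 \<le> omega E V"
proof -
  have "omega E (nbhd V x) + card {x} \<le> omega E V"
  proof (rule omega_complete_le[OF assms(1) _ _ _ symp irreflp])
    show "E u v" if "u \<in> nbhd V x" "v \<in> {x}" for u v
      using that sym[of x u] by (simp add: nbhd_def)
  qed (use assms(2) in \<open>auto simp: nbhd_def pairwise_def\<close>)
  then show ?thesis by simp
qed

context
  fixes V C :: "'a set" and x :: 'a
  assumes fin: "finite V" and x: "x \<in> V" and C: "C \<subseteq> conbhd V x" "pairwise E C"
begin

lemma clique_in_conbhd: "finite C" "C \<subseteq> V" "\<forall>c\<in>C. \<not> E x c"
  using C(1) fin by (auto simp: conbhd_def intro: finite_subset)

lemma card_miss_two:
  "card {w \<in> V. E x w \<and> 2 \<le> card (miss C w)} \<le> omega E V - 1"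
proof -
  have "card {w \<in> V. E x w \<and> 2 \<le> card (miss C w)} \<le> omega E (nbhd V x)"
    using pairwise_miss_two[OF clique_in_conbhd(1) C(2) clique_in_conbhd(3), of V] fin
    by (intro card_le_omega) (simp_all add: nbhd_def Collect_mono)
  then show ?thesis using omega_nbhd_less[OF fin x] by linarith
qed

text \<open>With \<open>c\<close> inserted every summand is at least 1, so this limits the total
  excess over \<open>card C\<close>.\<close>

lemma sum_omega_missing_one:
  "(\<Sum>c\<in>C. omega E (insert c (missing_one V x C c))) \<le> omega E V"
proof -
  have "(\<Sum>c\<in>C. omega E (insert c (missing_one V x C c)))
      \<le> omega E (\<Union>c\<in>C. insert c (missing_one V x C c))"
  proof (rule sum_omega_join_le[OF clique_in_conbhd(1) _ symp irreflp])
    fix c c' u v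
    assume "c \<in> C" "c' \<in> C" "c \<noteq> c'"
      and "u \<in> insert c (missing_one V x C c)" "v \<in> insert c' (missing_one V x C c')"
    then show "E u v" unfolding missing_one_def by (rule miss_one_join[OF C(2) clique_in_conbhd(3)])
  qed (use fin in \<open>simp add: missing_one_def\<close>)
  also have "\<dots> \<le> omega E V"
    using fin clique_in_conbhd(2) by (intro omega_mono) (auto simp: missing_one_def)
  finally show ?thesis .
qed

text \<open>Without the vertices of \<open>C\<close> all the sets lie in the neighbourhood of
  \<open>x\<close>, which saves one.\<close>

lemma sum_omega_missing_one_less:
  "(\<Sum>c\<in>C. omega E (missing_one V x C c)) \<le> omega E V - 1"
proof -
  have "(\<Sum>c\<in>C. omega E (missing_one V x C c)) \<le> omega E (\<Union>c\<in>C. missing_one V x C c)"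
  proof (rule sum_omega_join_le[OF clique_in_conbhd(1) _ symp irreflp])
    fix c c' u v
    assume "c \<in> C" "c' \<in> C" "c \<noteq> c'" "u \<in> missing_one V x C c" "v \<in> missing_one V x C c'"
    then show "E u v"
      unfolding missing_one_def by (intro miss_one_join[OF C(2) clique_in_conbhd(3), of c c' u V v]) auto
  qed (use fin in \<open>simp add: missing_one_def\<close>)
  also have "\<dots> \<le> omega E (nbhd V x)"
    using fin by (intro omega_mono) (auto simp: missing_one_def nbhd_def)
  also have "\<dots> \<le> omega E V - 1" using omega_nbhd_less[OF fin x] by linarith
  finally show ?thesis .
qed

text \<open>Each of these neighbours misses nothing of \<open>C\<close> or only a vertex outside
  \<open>J\<close>, so \<open>J\<close> extends every clique among them.\<close>

lemma omega_complete_part: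
  assumes "J \<subseteq> C"
  shows "omega E ({w \<in> V. E x w \<and> miss C w = {}} \<union> (\<Union>c\<in>C - J. missing_one V x C c)) + card J \<le> omega E V"
proof (rule omega_complete_le[OF fin _ _ _ symp irreflp])
  show "J \<subseteq> V" using assms clique_in_conbhd(2) by blast
  show "pairwise E J" using assms C(2) by (rule pairwise_subset[rotated])
  show "{w \<in> V. E x w \<and> miss C w = {}} \<union> (\<Union>c\<in>C - J. missing_one V x C c) \<subseteq> V"
    by (auto simp: missing_one_def)
  show "E u v" if "u \<in> {w \<in> V. E x w \<and> miss C w = {}} \<union> (\<Union>c\<in>C - J. missing_one V x C c)" "v \<in> J" for u v
  proof -
    have "v \<notin> miss C u" using that by (auto simp: missing_one_def)
    then show ?thesis using that(2) assms by (auto simp: miss_def)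
  qed
qed

text \<open>A larger \<open>J\<close> lowers the bound on the clique number of the first part but
  leaves more sets to be coloured separately; the choice stays open.\<close>

lemma nbhd_split:
  assumes "J \<subseteq> C"
  shows "nbhd V x = ({w \<in> V. E x w \<and> miss C w = {}} \<union> (\<Union>c\<in>C - J. missing_one V x C c))
    \<union> {w \<in> V. E x w \<and> 2 \<le> card (miss C w)} \<union> (\<Union>c\<in>J. missing_one V x C c)" (is "_ = ?R")
proof
  show "?R \<subseteq> nbhd V x" by (auto simp: nbhd_def missing_one_def)
  show "nbhd V x \<subseteq> ?R"
  proof
    fix w assume w: "w \<in> nbhd V x"
    have "finite (miss C w)" using clique_in_conbhd(1) by (simp add: miss_def)
    then consider "miss C w = {}" | "card (miss C w) = 1" | "2 \<le> card (miss C w)"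
      by (cases "card (miss C w)") (auto, fastforce)
    then show "w \<in> ?R"
    proof cases
      case 2
      then obtain c where c: "miss C w = {c}" using card_1_singletonE by blast
      then have "c \<in> C" by (auto simp: miss_def)
      then show ?thesis using c w by (cases "c \<in> J") (auto simp: nbhd_def missing_one_def)
    qed (use w in \<open>auto simp: nbhd_def\<close>)
  qed
qed

lemma colourable_nbhd:
  assumes IH: "\<And>T. T \<subset> V \<Longrightarrow> colourable E T (chi_bound (omega E T))"
    and J: "J \<subseteq> C"
  shows "colourable E (nbhd V x) (chi_bound (omega E V - card J) + (omega E V - 1)
    + (\<Sum>c\<in>J. chi_bound (omega E (insert c (missing_one V x C c)))))"
proof -
  let ?Z = "{w \<in> V. E x w \<and> miss C w = {}} \<union> (\<Union>c\<in>C - J. missing_one V x C c)"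
  have proper: "T \<subset> V" if "T \<subseteq> nbhd V x" for T
    using that x irrefl by (auto simp: nbhd_def)
  have "colourable E ?Z (chi_bound (omega E ?Z))"
    using nbhd_split[OF J] by (intro IH proper) blast
  moreover have "omega E ?Z \<le> omega E V - card J" using omega_complete_part[OF J] by linarith
  ultimately have 1: "colourable E ?Z (chi_bound (omega E V - card J))"
    by (rule colourable_mono[OF _ order_refl chi_bound_mono])
  have "colourable E {w \<in> V. E x w \<and> 2 \<le> card (miss C w)} (card {w \<in> V. E x w \<and> 2 \<le> card (miss C w)})"
    using fin irreflp by (intro colourable_card) auto
  then have 2: "colourable E {w \<in> V. E x w \<and> 2 \<le> card (miss C w)} (omega E V - 1)"
    using card_miss_two by (rule colourable_mono[OF _ order_refl])
  have 3: "colourable E (\<Union>c\<in>J. missing_one V x C c)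
    (\<Sum>c\<in>J. chi_bound (omega E (insert c (missing_one V x C c))))"
  proof (rule colourable_UN)
    show "finite J" using J clique_in_conbhd(1) by (rule finite_subset)
    fix c assume "c \<in> J"
    have "colourable E (missing_one V x C c) (chi_bound (omega E (missing_one V x C c)))"
      by (intro IH proper) (auto simp: missing_one_def nbhd_def)
    \<comment> \<open>Inserting \<open>c\<close> gives the positive clique numbers with bounded sum
      from which \<open>J\<close> is chosen.\<close>
    moreover have "omega E (missing_one V x C c) \<le> omega E (insert c (missing_one V x C c))"
      using fin by (intro omega_mono) (auto simp: missing_one_def)
    ultimately show "colourable E (missing_one V x C c) (chi_bound (omega E (insert c (missing_one V x C c))))"
      by (rule colourable_mono[OF _ order_refl chi_bound_mono])
  qed
  show ?thesis
    unfolding nbhd_split[OF J] using 1 2 3 by (intro colourable_Un)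
qed

text \<open>Here \<open>card C\<close> summands, each at least 1, add up to at most
  \<open>card C\<close>, so all equal 1 and each \<open>missing_one V x C c\<close> is edgeless. A
  neighbour missing nothing would extend the maximum clique \<open>C\<close>. The two remaining
  kinds cost \<open>omega E V - 1\<close> colours each.\<close>

lemma colourable_nbhd_max:
  assumes "card C = omega E V"
  shows "colourable E (nbhd V x) (2 * (omega E V - 1))"
proof -
  have one: "omega E (insert c (missing_one V x C c)) = 1" if "c \<in> C" for c
  proof -
    have pos: "1 \<le> omega E (insert d (missing_one V x C d))" for d
      using omega_pos[of "insert d (missing_one V x C d)" d E] fin by (auto simp: missing_one_def)
    have "(\<Sum>d\<in>C. omega E (insert d (missing_one V x C d))) \<le> (\<Sum>d\<in>C. 1)"
      using sum_omega_missing_one assms by simp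
    then show ?thesis
      using sum_mono_inv[of "\<lambda>_. 1" C "\<lambda>d. omega E (insert d (missing_one V x C d))" c] pos that clique_in_conbhd(1)
      by (metis (no_types, lifting) le_antisym sum_mono)
  qed
  \<comment> \<open>Counting \<open>omega\<close> colours instead of 1 charges nothing for an empty
    set, which keeps the total at most \<open>omega E V - 1\<close>. The path condition holds
    vacuously, as there are no edges.\<close>
  have "colourable E (missing_one V x C c) (omega E (missing_one V x C c))" if c: "c \<in> C" for c
  proof (rule colourable_P3_free[OF _ symp irreflp])
    show fin': "finite (missing_one V x C c)" using fin by (simp add: missing_one_def)
    fix u v w assume uv: "u \<in> missing_one V x C c" "v \<in> missing_one V x C c" "E u v"
    have "card {u, v} \<le> omega E (insert c (missing_one V x C c))"
      using uv sym[OF uv(3)] fin' by (intro card_le_omega) (auto simp: pairwise_def)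
    then show "E u w" using one[OF c] uv(3) irrefl by (cases "u = v") auto
  qed
  then have "colourable E (\<Union>c\<in>C. missing_one V x C c) (\<Sum>c\<in>C. omega E (missing_one V x C c))"
    by (rule colourable_UN[OF clique_in_conbhd(1)])
  then have 3: "colourable E (\<Union>c\<in>C. missing_one V x C c) (omega E V - 1)"
    using sum_omega_missing_one_less by (rule colourable_mono[OF _ order_refl])
  let ?Z = "{w \<in> V. E x w \<and> miss C w = {}} \<union> (\<Union>c\<in>C - C. missing_one V x C c)"
  have "omega E ?Z = 0" using omega_complete_part[OF order_refl] assms by linarith
  moreover have "finite ?Z" using fin by simp
  ultimately have "?Z = {}" using omega_pos[of ?Z _ E] by (metis all_not_in_conv less_not_refl)
  then have 1: "colourable E ?Z 0" by (simp only: colourable_empty)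
  have "colourable E {w \<in> V. E x w \<and> 2 \<le> card (miss C w)} (card {w \<in> V. E x w \<and> 2 \<le> card (miss C w)})"
    using fin irreflp by (intro colourable_card) auto
  then have 2: "colourable E {w \<in> V. E x w \<and> 2 \<le> card (miss C w)} (omega E V - 1)"
    using card_miss_two by (rule colourable_mono[OF _ order_refl])
  have "colourable E (nbhd V x) (0 + (omega E V - 1) + (omega E V - 1))"
    unfolding nbhd_split[OF order_refl] using 1 2 3 by (intro colourable_Un)
  then show ?thesis by (simp add: mult_2)
qed

end

section \<open>The induction on the vertex set\<close>

theorem colourable_chi_bound:
  assumes "finite V"
  shows "colourable E V (chi_bound (omega E V))"
  using assms
proof (induction V rule: finite_psubset_induct)
  case (psubset V)
  let ?n = "omega E V"
  show ?case
  proof (cases "\<exists>x\<in>V. omega E (conbhd V x) < ?n")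
    case True
    then obtain x where x: "x \<in> V" and a: "omega E (conbhd V x) < ?n" by blast
    let ?a = "omega E (conbhd V x)"
    have V: "V = insert x (conbhd V x) \<union> nbhd V x"
      using x irrefl by (auto simp: nbhd_def conbhd_def)
    \<comment> \<open>\<open>x\<close> has no neighbour in \<open>conbhd V x\<close> and reuses a
      colour; the \<open>max\<close> covers an empty \<open>conbhd V x\<close>, where
      \<open>chi_bound\<close> gives 0.\<close>
    have x_conbhd: "colourable E (insert x (conbhd V x)) (max 1 (chi_bound ?a))"
    proof -
      have "colourable E (conbhd V x) (chi_bound ?a)"
        using x by (intro psubset.IH) (auto simp: conbhd_def)
      then have "colourable E (conbhd V x) (max 1 (chi_bound ?a))" by (rule colourable_mono) auto
      moreover have "colourable E {x} (max 1 (chi_bound ?a))"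
        using colourable_indep[of "{x}" E] irrefl by (auto intro: colourable_mono)
      ultimately have "colourable E ({x} \<union> conbhd V x) (max 1 (chi_bound ?a))"
        by (intro colourable_Un_anticomplete symp) (auto simp: conbhd_def)
      then show ?thesis by simp
    qed
    show ?thesis
    proof (cases "3 * ?n \<le> chi_bound ?a + 1")
      \<comment> \<open>So \<open>chi_bound ?a\<close> is at most \<open>3 * ?n - 2\<close>, the
        last increment of \<open>chi_bound\<close>.\<close>
      case False
      have "colourable E (nbhd V x) (chi_bound (omega E (nbhd V x)))"
        using x irrefl by (intro psubset.IH) (auto simp: nbhd_def)
      moreover have "omega E (nbhd V x) \<le> ?n - 1"
        using omega_nbhd_less[OF psubset.hyps x] by linarith
      ultimately have "colourable E (nbhd V x) (chi_bound (?n - 1))"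
        by (rule colourable_mono[OF _ order_refl chi_bound_mono])
      then have "colourable E V (max 1 (chi_bound ?a) + chi_bound (?n - 1))"
        using x_conbhd V by (metis colourable_Un)
      moreover have "max 1 (chi_bound ?a) + chi_bound (?n - 1) \<le> chi_bound ?n"
        using False a by (cases ?n) auto
      ultimately show ?thesis by (rule colourable_mono[OF _ order_refl])
    next
      case True
      have "finite (conbhd V x)" using psubset.hyps by (simp add: conbhd_def)
      then obtain C where C: "C \<subseteq> conbhd V x" "pairwise E C" "card C = ?a"
        by (rule omega_clique)
      have finC: "finite C" using C(1) \<open>finite (conbhd V x)\<close> by (rule finite_subset)
      let ?w = "\<lambda>c. omega E (insert c (missing_one V x C c))"
      have "1 \<le> ?w c" for c
        using omega_pos[of "insert c (missing_one V x C c)" c E] psubset.hyps by (auto simp: missing_one_def)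
      then obtain J where J: "J \<subseteq> C"
        "chi_bound (?n - card J) + chi_bound (card C) + (?n - 1) + (\<Sum>c\<in>J. chi_bound (?w c)) \<le> chi_bound ?n"
        using exists_cheap_subset[OF finC, of ?n ?w] a True C(3)
          sum_omega_missing_one[OF psubset.hyps x C(1,2)] by metis
      have "colourable E (nbhd V x) (chi_bound (?n - card J) + (?n - 1) + (\<Sum>c\<in>J. chi_bound (?w c)))"
        using colourable_nbhd[OF psubset.hyps x C(1,2) psubset.IH J(1)] by blast
      then have "colourable E V (max 1 (chi_bound ?a) + (chi_bound (?n - card J) + (?n - 1) + (\<Sum>c\<in>J. chi_bound (?w c))))"
        using x_conbhd V by (metis colourable_Un)
      \<comment> \<open>\<open>True\<close> forces \<open>chi_bound ?a \<ge> 2\<close>, because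
        \<open>?n\<close> is positive.\<close>
      moreover have "max 1 (chi_bound ?a) = chi_bound (card C)" using True a C(3) by auto
      ultimately show ?thesis using J(2) by (auto intro: colourable_mono)
    qed
  next
    \<comment> \<open>Every non-neighbourhood now contains a clique of size
      \<open>?n\<close>.\<close>
    case max: False
    show ?thesis
    proof (cases "\<exists>x\<in>V. \<exists>w\<in>V. E x w")
      case False
      then have "colourable E V 1" by (intro colourable_indep) auto
      moreover have "1 \<le> chi_bound ?n" if "V \<noteq> {}"
        using chi_bound_mono[of 1 ?n] omega_pos[of V _ E] psubset.hyps that by (force simp: Suc_le_eq)
      ultimately show ?thesis by (cases "V = {}") (auto simp: colourable_empty intro: colourable_mono)
    next
      case True
      then obtain x w where xw: "x \<in> V" "w \<in> V" "E x w" by blast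
      have n2: "2 \<le> ?n"
      proof -
        have "card {x, w} \<le> ?n" using xw sym[OF xw(3)] psubset.hyps by (intro card_le_omega) (auto simp: pairwise_def)
        moreover have "x \<noteq> w" using xw irrefl by auto
        ultimately show ?thesis by simp
      qed
      \<comment> \<open>An induced path on three vertices in \<open>?F\<close> would have no edge to
        the edge \<open>xw\<close>, so \<open>?F\<close> induces a union of cliques.\<close>
      let ?F = "{v \<in> V. v \<noteq> x \<and> v \<noteq> w \<and> \<not> E x v \<and> \<not> E w v}"
      have "colourable E ?F (omega E ?F)"
      proof (rule colourable_P3_free[OF _ symp irreflp])
        show "finite ?F" using psubset.hyps by simp
        fix a b c assume "a \<in> ?F" "b \<in> ?F" "c \<in> ?F" "E a b" "E b c" "a \<noteq> c"
        then show "E a c" using no_P3_P2[of a b c x w] xw(3) sym by blast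
      qed
      moreover have "omega E ?F \<le> ?n" using psubset.hyps by (intro omega_mono) auto
      ultimately have F: "colourable E ?F ?n" by (rule colourable_mono[OF _ order_refl])
      have V: "V = nbhd V x \<union> nbhd V w \<union> ?F" using xw sym[OF xw(3)] by (auto simp: nbhd_def)
      obtain k where k: "\<And>y. y \<in> {x, w} \<Longrightarrow> colourable E (nbhd V y) k" "k + k + ?n \<le> chi_bound ?n"
      proof (cases "?n = 2")
        \<comment> \<open>The general count 2 + 2 + 2 would exceed \<open>chi_bound 2 = 5\<close>.
          Here neighbourhoods have clique number at most 1, so one colour each is enough.\<close>
        case True
        have "colourable E (nbhd V y) 1" if "y \<in> V" for y
        proof -
          have "colourable E (nbhd V y) (chi_bound (omega E (nbhd V y)))"
            using that irrefl by (intro psubset.IH) (auto simp: nbhd_def)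
          moreover have "chi_bound (omega E (nbhd V y)) \<le> chi_bound 1"
            using omega_nbhd_less[OF psubset.hyps that] True by (intro chi_bound_mono) linarith
          ultimately have "colourable E (nbhd V y) (chi_bound 1)" by (rule colourable_mono[OF _ order_refl])
          then show ?thesis by simp
        qed
        then show ?thesis using that[of 1] xw True by (auto simp: numeral_2_eq_2)
      next
        case False
        have "colourable E (nbhd V y) (2 * (?n - 1))" if "y \<in> V" for y
        proof -
          have "finite (conbhd V y)" using psubset.hyps by (simp add: conbhd_def)
          then obtain C where C: "C \<subseteq> conbhd V y" "pairwise E C" "card C = omega E (conbhd V y)"
            by (rule omega_clique)
          have "omega E (conbhd V y) \<le> ?n" using psubset.hyps by (intro omega_mono) (auto simp: conbhd_def)
          then have "card C = ?n" using max that C(3) by (metis le_antisym linorder_not_less)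
          then show ?thesis using colourable_nbhd_max[OF psubset.hyps that C(1,2)] by blast
        qed
        moreover have "2 * (?n - 1) + 2 * (?n - 1) + ?n \<le> chi_bound ?n"
          using chi_bound_ge_linear[of ?n] False n2 by linarith
        ultimately show ?thesis using that[of "2 * (?n - 1)"] xw by blast
      qed
      have "colourable E (nbhd V x \<union> nbhd V w \<union> ?F) (k + k + ?n)"
        using k(1) F by (intro colourable_Un) auto
      then have "colourable E V (k + k + ?n)" using V by metis
      then show ?thesis using k(2) by (rule colourable_mono[OF _ order_refl])
    qed
  qed
qed

end

section \<open>From excluded induced subgraphs to the adjacency relation\<close>

text \<open>The subgraph induced on the image of \<open>\<phi>\<close> is a copy of
  \<open>H\<close>. The isomorphism must run from that copy to \<open>H\<close>, hence it is built
  from the inverse of \<open>\<phi>\<close>.\<close>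

lemma no_induced_embedding:
  fixes \<phi> :: "'b \<Rightarrow> 'a"
  assumes "pair_wf_digraph G" "induced_free G H"
    and H: "parcs H \<subseteq> pverts H \<times> pverts H"
    and inj: "inj_on \<phi> (pverts H)" and range: "\<phi> ` pverts H \<subseteq> pverts G"
    and arcs: "\<And>u v. u \<in> pverts H \<Longrightarrow> v \<in> pverts H \<Longrightarrow> (\<phi> u, \<phi> v) \<in> parcs G \<longleftrightarrow> (u, v) \<in> parcs H"
  shows False
proof -
  define V where "V = \<phi> ` pverts H"
  define K where "K = \<lparr>pverts = V, parcs = {e \<in> parcs G. fst e \<in> V \<and> snd e \<in> V}\<rparr>"
  define g where "g = the_inv_into (pverts H) \<phi>"
  define f where "f = \<lparr>iso_verts = g, iso_arcs = map_prod g g, iso_head = snd, iso_tail = fst\<rparr>"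
  have g\<phi>: "g (\<phi> u) = u" if "u \<in> pverts H" for u
    using inj that by (simp add: g_def the_inv_into_f_f)
  interpret pair_wf_digraph G by fact
  have "wf_digraph (with_proj G)" by unfold_locales
  moreover have wfK: "wf_digraph (with_proj K)" by unfold_locales (auto simp: K_def)
  ultimately have "induced_subgraph (with_proj K) (with_proj G)"
    using range by (auto simp: induced_subgraph_def subgraph_def compatible_def K_def V_def)
  moreover have "digraph_iso (with_proj K) (with_proj H)"
    unfolding digraph_iso_def
  proof (intro exI conjI)
    have inj_g: "inj_on g V" by (rule inj_onI) (auto simp: V_def g\<phi>)
    then have "inj_on (map_prod g g) (parcs K)"
      by (intro inj_on_subset[OF map_prod_inj_on[OF inj_g inj_g]]) (auto simp: K_def)
    then show "pre_digraph.digraph_isomorphism (with_proj K) f"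
      using wfK inj_g by (auto simp: pre_digraph.digraph_isomorphism_def f_def K_def)
    have "map_prod g g ` parcs K = parcs H"
    proof
      show "map_prod g g ` parcs K \<subseteq> parcs H" by (auto simp: K_def V_def g\<phi> arcs)
      show "parcs H \<subseteq> map_prod g g ` parcs K"
      proof
        fix e assume e: "e \<in> parcs H"
        then obtain u v where uv: "e = (u, v)" "u \<in> pverts H" "v \<in> pverts H" using H by blast
        then have "(\<phi> u, \<phi> v) \<in> parcs K" using e arcs by (auto simp: K_def V_def)
        then show "e \<in> map_prod g g ` parcs K" using uv g\<phi> by (force intro: rev_image_eqI)
      qed
    qed
    moreover have "g ` V = pverts H" by (auto simp: V_def g\<phi> image_image)
    ultimately show "with_proj H = app_iso f (with_proj K)"
      by (simp add: app_iso_def f_def with_proj_def K_def)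
  qed
  ultimately show False using assms(2) unfolding induced_free_def by blast
qed

lemma (in pair_graph) adj_facts:
  "(u, v) \<in> parcs G \<Longrightarrow> (v, u) \<in> parcs G" "(u, u) \<notin> parcs G"
  using arcs_symmetric pair_no_loops by (blast, fastforce)

text \<open>A violated axiom provides five vertices with prescribed edges and non-edges; listing
  them in order embeds the excluded graph.\<close>

lemma (in pair_graph) P3P2_C5_free_parcs:
  assumes P: "induced_free G (disjoint_union_graph (path_graph 3) (path_graph 2))"
    and C5: "induced_free G (cycle_graph 5)"
  shows "P3P2_C5_free (\<lambda>u v. (u, v) \<in> parcs G)"
proof
  have wf: "pair_wf_digraph G" by unfold_locales
  show "symp (\<lambda>u v. (u, v) \<in> parcs G)" by (rule sympI) (rule adj_facts)
  show "irreflp (\<lambda>u v. (u, v) \<in> parcs G)" by (rule irreflpI) (rule adj_facts)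
  fix a b c d e
  {
    assume edges: "(a, b) \<in> parcs G" "(b, c) \<in> parcs G" "(d, e) \<in> parcs G" "a \<noteq> c" "(a, c) \<notin> parcs G"
    show "(a, d) \<in> parcs G \<or> (a, e) \<in> parcs G \<or> (b, d) \<in> parcs G \<or> (b, e) \<in> parcs G
      \<or> (c, d) \<in> parcs G \<or> (c, e) \<in> parcs G"
    proof (rule ccontr)
      assume n: "\<not> ?thesis"
      let ?\<phi> = "case_sum (\<lambda>i. [a, b, c] ! i) (\<lambda>i::nat. [d, e] ! i)"
      let ?H = "disjoint_union_graph (path_graph 3) (path_graph 2)"
      have V: "pverts ?H = {Inl 0, Inl 1, Inl 2, Inr 0, Inr 1}"
        by (auto simp: disjoint_union_graph_def path_graph_def less_Suc_eq numeral_eq_Suc)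
      have A: "(Inl i, Inl j) \<in> parcs ?H \<longleftrightarrow> i < 3 \<and> j < 3 \<and> (j = Suc i \<or> i = Suc j)"
        "(Inr i, Inr j) \<in> parcs ?H \<longleftrightarrow> i < 2 \<and> j < 2 \<and> (j = Suc i \<or> i = Suc j)"
        "(Inl i, Inr j) \<notin> parcs ?H" "(Inr i, Inl j) \<notin> parcs ?H" for i j
        by (auto simp: disjoint_union_graph_def path_graph_def)
      have verts: "a \<in> pverts G" "b \<in> pverts G" "c \<in> pverts G" "d \<in> pverts G" "e \<in> pverts G"
        using edges in_arcsD1 in_arcsD2 by blast+
      have rev: "(b, a) \<in> parcs G" "(c, b) \<in> parcs G" "(e, d) \<in> parcs G" "(c, a) \<notin> parcs G"
        "(d, a) \<notin> parcs G" "(e, a) \<notin> parcs G" "(d, b) \<notin> parcs G" "(e, b) \<notin> parcs G"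
        "(d, c) \<notin> parcs G" "(e, c) \<notin> parcs G"
        using edges n adj_facts(1) by blast+
      \<comment> \<open>Identifying two of these vertices would turn a prescribed edge into a
        non-edge or a loop.\<close>
      have neq: "a \<noteq> b" "b \<noteq> c" "d \<noteq> e" "a \<noteq> d" "a \<noteq> e" "b \<noteq> d" "b \<noteq> e" "c \<noteq> d" "c \<noteq> e"
        using edges n rev adj_facts(2) by blast+
      show False
      proof (rule no_induced_embedding[OF wf P, of ?\<phi>])
        show "parcs ?H \<subseteq> pverts ?H \<times> pverts ?H"
          by (auto simp: disjoint_union_graph_def path_graph_def)
        show "inj_on ?\<phi> (pverts ?H)" unfolding V using neq edges(4) by (auto simp: inj_on_def)
        show "?\<phi> ` pverts ?H \<subseteq> pverts G" unfolding V using verts by auto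
        \<comment> \<open>All 25 pairs of vertices are checked one by one.\<close>
        show "(?\<phi> u, ?\<phi> v) \<in> parcs G \<longleftrightarrow> (u, v) \<in> parcs ?H" if "u \<in> pverts ?H" "v \<in> pverts ?H" for u v
          using that unfolding V insert_iff empty_iff
          by (elim disjE FalseE; hypsubst; use edges n rev in \<open>simp add: A adj_facts(2)\<close>)
      qed
    qed
  next
    assume edges: "(a, b) \<in> parcs G" "(b, c) \<in> parcs G" "(c, d) \<in> parcs G" "(d, e) \<in> parcs G" "(e, a) \<in> parcs G"
    show "(a, c) \<in> parcs G \<or> (b, d) \<in> parcs G \<or> (c, e) \<in> parcs G \<or> (d, a) \<in> parcs G \<or> (e, b) \<in> parcs G"
    proof (rule ccontr)
      assume n: "\<not> ?thesis"
      let ?\<phi> = "\<lambda>i. [a, b, c, d, e] ! i"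
      let ?H = "cycle_graph 5"
      have V: "pverts ?H = {0, 1, 2, 3, 4}" by (auto simp: cycle_graph_def)
      have A: "(i, j) \<in> parcs ?H \<longleftrightarrow> i < 5 \<and> j < 5 \<and> (j = Suc i mod 5 \<or> i = Suc j mod 5)" for i j
        by (simp add: cycle_graph_def)
      have verts: "a \<in> pverts G" "b \<in> pverts G" "c \<in> pverts G" "d \<in> pverts G" "e \<in> pverts G"
        using edges in_arcsD1 by blast+
      have rev: "(b, a) \<in> parcs G" "(c, b) \<in> parcs G" "(d, c) \<in> parcs G" "(e, d) \<in> parcs G" "(a, e) \<in> parcs G"
        "(c, a) \<notin> parcs G" "(d, b) \<notin> parcs G" "(e, c) \<notin> parcs G" "(a, d) \<notin> parcs G" "(b, e) \<notin> parcs G"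
        using edges n adj_facts(1) by blast+
      have neq: "a \<noteq> b" "a \<noteq> c" "a \<noteq> d" "a \<noteq> e" "b \<noteq> c" "b \<noteq> d" "b \<noteq> e" "c \<noteq> d" "c \<noteq> e" "d \<noteq> e"
        using edges n rev adj_facts(2) by blast+
      show False
      proof (rule no_induced_embedding[OF wf C5, of ?\<phi>])
        show "parcs ?H \<subseteq> pverts ?H \<times> pverts ?H" by (auto simp: cycle_graph_def)
        show "inj_on ?\<phi> (pverts ?H)" unfolding V using neq by (auto simp: inj_on_def)
        show "?\<phi> ` pverts ?H \<subseteq> pverts G" unfolding V using verts by auto
        show "(?\<phi> u, ?\<phi> v) \<in> parcs G \<longleftrightarrow> (u, v) \<in> parcs ?H" if "u \<in> pverts ?H" "v \<in> pverts ?H" for u v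
          using that unfolding V insert_iff empty_iff
          by (elim disjE FalseE; hypsubst; use edges n rev in \<open>simp add: A adj_facts(2)\<close>)
      qed
    qed
  }
qed

theorem theorem1p5:
  fixes G :: "'a pair_pre_digraph"
  assumes "pair_graph G"
    and "induced_free G (disjoint_union_graph (path_graph 3) (path_graph 2))"
    and "induced_free G (cycle_graph 5)"
  shows "real (chromatic_number G)
    \<le> (3 * real (clique_number G) ^ 2 + real (clique_number G)) / 2"
proof -
  interpret pair_graph G by fact
  let ?E = "\<lambda>u v. (u, v) \<in> parcs G"
  interpret P3P2_C5_free ?E by (rule P3P2_C5_free_parcs[OF assms(2,3)])
  have omega: "omega ?E (pverts G) = clique_number G"
    by (simp add: omega_def clique_number_def is_clique_def)
  have "colourable ?E (pverts G) (chi_bound (clique_number G))"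
    using colourable_chi_bound[OF pair_finite_verts] by (simp only: omega)
  \<comment> \<open>\<open>proper_colouring\<close> ranges over arcs and \<open>colourable\<close>
    over pairs of vertices; well-formedness puts the ends of arcs among the vertices.\<close>
  then obtain c where "proper_colouring G (chi_bound (clique_number G)) c"
    unfolding colourable_def proper_colouring_def using wellformed' by blast
  then have "chromatic_number G \<le> chi_bound (clique_number G)"
    unfolding chromatic_number_def by (intro Least_le) blast
  then have "real (chromatic_number G) \<le> (3 * real (clique_number G) ^ 2 - real (clique_number G)) / 2"
    using chi_bound_real by (metis of_nat_le_iff)
  \<comment> \<open>The bound obtained is smaller by exactly the clique number.\<close>
  also have "\<dots> \<le> (3 * real (clique_number G) ^ 2 + real (clique_number G)) / 2" by simp
  finally show ?thesis .
qed

end
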